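(* Let $\mathcal C$ be the Clebsch graph, i.e. the graph whose vertices are the 16 binary strings of length 4, two strings being adjacent if and only if they differ in exactly one bit or in all four bits (this is the strongly regular graph with parameters $(16,5,0,2)$). Then $q(\mathcal C)=2$.
   Context: For a graph $G$ on vertices $v_1,\dots,v_n$, $\mathcal S(G)$ is the set of real symmetric $n\times n$ matrices $A=[a_{ij}]$ such that for $i\neq j$, $a_{ij}\neq 0$ if and only if $v_i$ and $v_j$ are adjacent (diagonal entries are unrestricted). $q(G)$ is the minimum, over $A\in\mathcal S(G)$, of the number of distinct eigenvalues of $A$. *)

theory Defs
  imports "HOL-Analysis.Analysis"
begin

text \<open>A graph is given by its adjacency relation on a finite vertex type \<open>'v\<close>; the rows and
  columns of a matrix are indexed by the vertices themselves.\<close>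

definition simple_graph :: "('v \<Rightarrow> 'v \<Rightarrow> bool) \<Rightarrow> bool" where
  "simple_graph adj \<longleftrightarrow> symp adj \<and> irreflp adj"

definition sym_matrices :: "('v::finite \<Rightarrow> 'v \<Rightarrow> bool) \<Rightarrow> (real^'v^'v) set" where
  "sym_matrices adj =
     {A. transpose A = A \<and> (\<forall>i j. i \<noteq> j \<longrightarrow> (A $ i $ j \<noteq> 0 \<longleftrightarrow> adj i j))}"

definition eigenvalues :: "real^'v^'v::finite \<Rightarrow> real set" where
  "eigenvalues A = {k. \<exists>x. x \<noteq> 0 \<and> A *v x = k *\<^sub>R x}"

text \<open>\<open>q(G)\<close>. The least element exists and is attained, and the eigenvalue sets are finite, so
  that \<^const>\<open>card\<close> really counts: see \<open>finite_eigenvalues\<close> and \<open>q_attained\<close> below.\<close>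

definition q :: "('v::finite \<Rightarrow> 'v \<Rightarrow> bool) \<Rightarrow> nat" where
  "q adj = (LEAST m. \<exists>A \<in> sym_matrices adj. m = card (eigenvalues A))"

definition clebsch :: "bool^4 \<Rightarrow> bool^4 \<Rightarrow> bool" where
  "clebsch x y \<longleftrightarrow> card {i. x $ i \<noteq> y $ i} = 1 \<or> card {i. x $ i \<noteq> y $ i} = 4"

lemma finite_eigenvalues:
  fixes A :: "real^'v^'v::finite"
  assumes "transpose A = A"
  shows "finite (eigenvalues A)"
proof -
  define e where "e k = (SOME x. x \<noteq> 0 \<and> A *v x = k *\<^sub>R x)" for k
  have e: "e k \<noteq> 0" "A *v e k = k *\<^sub>R e k" if "k \<in> eigenvalues A" for k
    using someI_ex[of "\<lambda>x. x \<noteq> 0 \<and> A *v x = k *\<^sub>R x"] that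
    by (auto simp: eigenvalues_def e_def)
  have orth: "e k \<bullet> e l = 0" if "k \<in> eigenvalues A" "l \<in> eigenvalues A" "k \<noteq> l" for k l
  proof -
    have "k * (e k \<bullet> e l) = (A *v e k) \<bullet> e l"
      using that by (simp add: e)
    also have "\<dots> = e k \<bullet> (A *v e l)"
      using dot_lmul_matrix[of "e k" A "e l"] assms
      by (metis transpose_matrix_vector)
    also have "\<dots> = l * (e k \<bullet> e l)"
      using that by (simp add: e)
    finally show ?thesis
      using that by simp
  qed
  have inj: "inj_on e (eigenvalues A)"
    by (rule inj_onI) (metis e(1) inner_eq_zero_iff orth)
  have "pairwise orthogonal (e ` eigenvalues A)"
    by (auto simp: pairwise_def orthogonal_def intro: orth)
  moreover have "0 \<notin> e ` eigenvalues A"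
    using e(1) by force
  ultimately have "finite (e ` eigenvalues A)"
    by (intro independent_imp_finite pairwise_orthogonal_independent)
  then show ?thesis
    using inj by (rule finite_imageD)
qed

lemma q_attained:
  fixes adj :: "'v::finite \<Rightarrow> 'v \<Rightarrow> bool"
  assumes "simple_graph adj"
  shows "\<exists>A \<in> sym_matrices adj. q adj = card (eigenvalues A)"
proof -
  have "(\<chi> i j. of_bool (adj i j)) \<in> sym_matrices adj"
    using assms by (auto simp: sym_matrices_def simple_graph_def transpose_def vec_eq_iff
        dest: sympD)
  then have "\<exists>m. \<exists>A \<in> sym_matrices adj. m = card (eigenvalues A)"
    by blast
  then show ?thesis
    unfolding q_def by (rule LeastI_ex)
qed

lemma simple_graph_clebsch: "simple_graph clebsch"
proof -
  have "{i. x $ i \<noteq> y $ i} = {i. y $ i \<noteq> x $ i}" for x y :: "bool^4"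
    by blast
  then have "symp clebsch"
    unfolding symp_def clebsch_def by metis
  moreover have "irreflp clebsch"
    by (simp add: irreflp_def clebsch_def)
  ultimately show ?thesis
    by (simp add: simple_graph_def)
qed

definition bits4 :: "bool \<Rightarrow> bool \<Rightarrow> bool \<Rightarrow> bool \<Rightarrow> bool^4" where
  "bits4 a b c d = (\<chi> i. if i = 1 then a else if i = 2 then b else if i = 3 then c else d)"

lemma bits4_nth [simp]:
  "bits4 a b c d $ 1 = a" "bits4 a b c d $ 2 = b" "bits4 a b c d $ 3 = c" "bits4 a b c d $ 4 = d"
  by (simp_all add: bits4_def)

lemma sum_bool4:
  fixes f :: "bool^4 \<Rightarrow> nat"
  shows "sum f UNIV = (\<Sum>a\<in>UNIV. \<Sum>b\<in>UNIV. \<Sum>c\<in>UNIV. \<Sum>d\<in>UNIV. f (bits4 a b c d))"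
proof -
  let ?h = "\<lambda>(a, b, c, d). bits4 a b c d"
  have "bij ?h"
    by (rule o_bij[where g = "\<lambda>x. (x $ 1, x $ 2, x $ 3, x $ 4)"])
      (auto simp: fun_eq_iff vec_eq_iff forall_4)
  then have "sum f UNIV = (\<Sum>t\<in>UNIV. f (?h t))"
    by (rule sum.reindex_bij_betw[symmetric])
  also have "\<dots> = (\<Sum>a\<in>UNIV. \<Sum>b\<in>UNIV. \<Sum>c\<in>UNIV. \<Sum>d\<in>UNIV. f (bits4 a b c d))"
    by (simp add: sum.cartesian_product case_prod_beta flip: UNIV_Times_UNIV)
  finally show ?thesis .
qed

lemma card_bool4:
  "card {y :: bool^4. P y} =
     (\<Sum>a\<in>UNIV. \<Sum>b\<in>UNIV. \<Sum>c\<in>UNIV. \<Sum>d\<in>UNIV. of_bool (P (bits4 a b c d)))"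
  by (subst sum_bool4[symmetric]) simp

lemma clebsch_iff:
  "clebsch x y \<longleftrightarrow>
     (\<Sum>i\<in>UNIV. of_bool (x $ i \<noteq> y $ i)) \<in> {1, 4 :: nat}"
  by (simp add: clebsch_def)

lemma sum_UNIV_bool: "(\<Sum>b\<in>UNIV. f b) = f False + f True"
  by (simp add: UNIV_bool)

lemma bits4_cases:
  obtains a b c d where "x = bits4 a b c d"
proof
  show "x = bits4 (x $ 1) (x $ 2) (x $ 3) (x $ 4)"
    by (simp add: vec_eq_iff forall_4)
qed

lemma bits4_eq_iff: "bits4 a b c d = bits4 a' b' c' d' \<longleftrightarrow> a = a' \<and> b = b' \<and> c = c' \<and> d = d'"
  by (simp add: vec_eq_iff forall_4)

lemma clebsch_bits4:
  "clebsch (bits4 a b c d) (bits4 a' b' c' d') \<longleftrightarrow>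
     (if a = a' then
        if b = b' then (c = c') \<noteq> (d = d') else c = c' \<and> d = d'
      else if b = b' then c = c' \<and> d = d' else c \<noteq> c' \<and> d \<noteq> d')"
proof -
  have "of_bool (\<not> p) + of_bool (\<not> q) + of_bool (\<not> r) + of_bool (\<not> s) \<in> {1, 4 :: nat} \<longleftrightarrow>
      (if p then if q then r \<noteq> s else r \<and> s else if q then r \<and> s else \<not> r \<and> \<not> s)" for p q r s
    by (cases p; cases q; cases r; cases s; simp)
  then show ?thesis
    unfolding clebsch_iff sum_4 bits4_nth .
qed

definition bits4_xor :: "bool^4 \<Rightarrow> bool^4 \<Rightarrow> bool^4" where
  "bits4_xor x y = (\<chi> i. x $ i \<noteq> y $ i)"

lemma clebsch_xor: "clebsch (bits4_xor w x) (bits4_xor w y) \<longleftrightarrow> clebsch x y"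
proof -
  have "{i. bits4_xor w x $ i \<noteq> bits4_xor w y $ i} = {i. x $ i \<noteq> y $ i}"
    by (auto simp: bits4_xor_def)
  then show ?thesis
    by (simp only: clebsch_def)
qed

lemma bij_bits4_xor: "bij (bits4_xor w)"
  by (rule o_bij[where g = "bits4_xor w"]) (auto simp: fun_eq_iff bits4_xor_def vec_eq_iff)

lemma bits4_xor_self: "bits4_xor x x = bits4 False False False False"
  by (simp add: bits4_xor_def vec_eq_iff forall_4)

lemma card_common_clebsch:
  "card {z. clebsch x z \<and> clebsch y z} =
     card {z. clebsch (bits4 False False False False) z \<and> clebsch (bits4_xor x y) z}"
proof -
  have "bij_betw (bits4_xor x) {z. clebsch x z \<and> clebsch y z}
      {z. clebsch (bits4_xor x x) z \<and> clebsch (bits4_xor x y) z}"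
    using bij_bits4_xor[of x]
    by (auto simp: bij_betw_def inj_on_def image_iff clebsch_xor) (metis clebsch_xor surjD)
  then show ?thesis
    unfolding bits4_xor_self by (rule bij_betw_same_card)
qed

lemma clebsch_strongly_regular:
  "CARD(bool^4) = 16"
  "card {y. clebsch x y} = 5"
  "clebsch x y \<Longrightarrow> card {z. clebsch x z \<and> clebsch y z} = 0"
  "x \<noteq> y \<Longrightarrow> \<not> clebsch x y \<Longrightarrow> card {z. clebsch x z \<and> clebsch y z} = 2"
proof -
  let ?o = "bits4 False False False False"
  show "CARD(bool^4) = 16"
    by simp
  have "card {z. clebsch ?o z} = 5"
    unfolding card_bool4 sum_UNIV_bool clebsch_bits4 by simp
  then show "card {y. clebsch x y} = 5"
    using card_common_clebsch[of x x] by (simp add: bits4_xor_self)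
  obtain a b c d where w: "bits4_xor x y = bits4 a b c d"
    by (rule bits4_cases)
  have adj: "clebsch x y \<longleftrightarrow> clebsch ?o (bits4 a b c d)"
    using clebsch_xor[of x x y] by (simp add: bits4_xor_self w)
  have eq: "x = y \<longleftrightarrow> ?o = bits4 a b c d"
    using bij_bits4_xor[of x] w bits4_xor_self[of x] by (metis bij_pointE)
  show "card {z. clebsch x z \<and> clebsch y z} = 0" if "clebsch x y"
    using that unfolding card_common_clebsch[of x y] w adj card_bool4 sum_UNIV_bool clebsch_bits4
    by (cases a; cases b; cases c; cases d) simp_all
  show "card {z. clebsch x z \<and> clebsch y z} = 2" if "x \<noteq> y" "\<not> clebsch x y"
    using that unfolding card_common_clebsch[of x y] w adj eq card_bool4 sum_UNIV_bool
      clebsch_bits4 bits4_eq_iff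
    by (cases a; cases b; cases c; cases d) simp_all
qed

end

theory Submission
  imports Defs
begin

text \<open>
  Upper bound: let \<open>X\<^sub>i\<close> flip the \<open>i\<close>-th bit and let \<open>Z\<^sub>i\<close> be the sign \<open>(-1)\<close> to the \<open>i\<close>-th bit.
  The five symmetric signed permutation matrices \<open>X\<^sub>1\<close>, \<open>X\<^sub>2 Z\<^sub>1\<close>, \<open>X\<^sub>3 Z\<^sub>1 Z\<^sub>2\<close>,
  \<open>X\<^sub>4 Z\<^sub>1 Z\<^sub>2 Z\<^sub>3\<close> and \<open>X\<^sub>1 X\<^sub>2 X\<^sub>3 X\<^sub>4 Z\<^sub>1 Z\<^sub>3\<close> square to the identity and anticommute pairwise.
  Their sum is a signed adjacency matrix of the Clebsch graph whose square is \<open>5 I\<close>, so its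
  eigenvalues lie in \<open>{\<surd>5, -\<surd>5}\<close>.

  Lower bound: the extreme values of the quadratic form of a symmetric matrix on the unit sphere
  are eigenvalues, so a symmetric matrix with a single eigenvalue is scalar and its graph has no
  edges.
\<close>

section \<open>Lower bound: extreme eigenvalues of a symmetric matrix\<close>

lemma symmetric_matrix_inner:
  fixes A :: "real^'n^'n"
  assumes "transpose A = A"
  shows "(A *v x) \<bullet> y = x \<bullet> (A *v y)"
  using dot_lmul_matrix[of x A y] assms by (metis transpose_matrix_vector)

text \<open>If \<open>B *v x\<close> were nonzero, a short move from \<open>x\<close> against it
  would make the form negative: the linear term in \<open>t\<close> dominates the quadratic
  one.\<close>

lemma psd_matrix_isotropic_in_kernel:
  fixes B :: "real^'n^'n"
  assumes sym: "transpose B = B" and psd: "\<And>y. 0 \<le> y \<bullet> (B *v y)" and x: "x \<bullet> (B *v x) = 0"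
  shows "B *v x = 0"
proof (rule ccontr)
  assume "B *v x \<noteq> 0"
  define y where "y = B *v x"
  define c where "c = y \<bullet> (B *v y)"
  have y: "y \<bullet> y > 0" and c: "c \<ge> 0"
    using \<open>B *v x \<noteq> 0\<close> psd by (simp_all add: y_def c_def)
  have xy: "x \<bullet> (B *v y) = y \<bullet> y"
    using symmetric_matrix_inner[OF sym, of x y] by (simp add: y_def)
  have expand: "(x - t *\<^sub>R y) \<bullet> (B *v (x - t *\<^sub>R y)) = t * (t * c - 2 * (y \<bullet> y))" for t
    using x xy
    by (simp add: matrix_vector_mult_diff_distrib matrix_vector_mult_scaleR inner_diff_left
        inner_diff_right c_def algebra_simps flip: y_def)
  \<comment> \<open>Any \<open>t > 0\<close> with \<open>t * c < 2 * (y \<bullet> y)\<close> works;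
    the \<open>+ 1\<close> keeps the denominator positive when \<open>c = 0\<close>.\<close>
  define t where "t = (y \<bullet> y) / (c + 1)"
  have t: "t > 0"
    using y c by (simp add: t_def)
  have "t * c \<le> t * (c + 1)"
    using t by simp
  also have "\<dots> = y \<bullet> y"
    using c by (simp add: t_def)
  finally have "t * (t * c - 2 * (y \<bullet> y)) < 0"
    using t y by (intro mult_pos_neg) linarith+
  then show False
    using psd[of "x - t *\<^sub>R y"] expand[of t] by simp
qed

lemma shifted_matrix_mult:
  fixes A :: "real^'n^'n"
  shows "(mat m - A) *v x = m *\<^sub>R x - A *v x"
proof -
  have "mat m *v x = m *\<^sub>R x"
    by (simp add: vec_eq_iff matrix_vector_mult_def mat_def if_distrib[where f = "\<lambda>u. u * _"]
        cong: if_cong)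
  then show ?thesis
    by (simp add: matrix_vector_mult_diff_rdistrib)
qed

text \<open>Take \<open>m\<close> as the maximum of the form on the unit sphere. By homogeneity
  \<open>mat m - A\<close> is positive semidefinite, and it vanishes as a form at the maximizer,
  which therefore lies in its kernel.\<close>

lemma symmetric_matrix_max_eigenvalue:
  fixes A :: "real^'n^'n"
  assumes sym: "transpose A = A"
  obtains m where "m \<in> eigenvalues A" "\<And>x. 0 \<le> x \<bullet> ((mat m - A) *v x)"
proof -
  let ?S = "sphere (0::real^'n) 1"
  have "continuous_on ?S (\<lambda>x. x \<bullet> (A *v x))"
    by (intro continuous_intros linear_continuous_on matrix_vector_mul_bounded_linear)
  moreover have "axis undefined 1 \<in> ?S"
    by simp
  ultimately obtain u where u: "u \<in> ?S" and max: "\<And>x. x \<in> ?S \<Longrightarrow> x \<bullet> (A *v x) \<le> u \<bullet> (A *v u)"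
    using continuous_attains_sup[OF compact_sphere, of 0 1 "\<lambda>x. x \<bullet> (A *v x)"] by blast
  define m where "m = u \<bullet> (A *v u)"
  have psd: "0 \<le> x \<bullet> ((mat m - A) *v x)" for x
  proof (cases "x = 0")
    case False
    define v where "v = x /\<^sub>R norm x"
    have x: "x = norm x *\<^sub>R v"
      using False by (simp add: v_def)
    have "v \<bullet> (A *v v) \<le> m"
      unfolding m_def by (rule max) (use False in \<open>simp add: v_def\<close>)
    moreover have "v \<bullet> v = 1"
      using False by (simp add: v_def dot_square_norm power2_eq_square)
    ultimately have "0 \<le> (norm x)\<^sup>2 * (v \<bullet> ((mat m - A) *v v))"
      by (simp add: shifted_matrix_mult inner_diff_right)
    also have "\<dots> = (norm x *\<^sub>R v) \<bullet> ((mat m - A) *v (norm x *\<^sub>R v))"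
      by (simp add: matrix_vector_mult_scaleR power2_eq_square)
    finally show ?thesis
      by (simp flip: x)
  qed simp
  have "transpose (mat m - A) = mat m - A"
    using sym by (auto simp: transpose_def vec_eq_iff mat_def)
  moreover have "u \<bullet> ((mat m - A) *v u) = 0"
    using u by (simp add: shifted_matrix_mult inner_diff_right m_def dot_square_norm)
  ultimately have "(mat m - A) *v u = 0"
    using psd by (intro psd_matrix_isotropic_in_kernel)
  then have "A *v u = m *\<^sub>R u"
    by (simp add: shifted_matrix_mult)
  moreover have "u \<noteq> 0"
    using u by auto
  ultimately have "m \<in> eigenvalues A"
    by (auto simp: eigenvalues_def)
  then show ?thesis
    using that psd by blast
qed

lemma uminus_matrix_vector_mult: "(- A) *v x = - (A *v x)" for A :: "real^'n^'m"
  by (simp add: vec_eq_iff matrix_vector_mult_def sum_negf)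

lemma eigenvalues_uminus: "k \<in> eigenvalues (- A) \<longleftrightarrow> - k \<in> eigenvalues A"
proof -
  have "- (A *v x) = k *\<^sub>R x \<longleftrightarrow> A *v x = (- k) *\<^sub>R x" for x
    by (metis minus_minus scaleR_minus_left)
  then show ?thesis
    by (simp add: eigenvalues_def uminus_matrix_vector_mult)
qed

lemma symmetric_matrix_few_eigenvalues_scalar:
  fixes A :: "real^'n^'n"
  assumes sym: "transpose A = A" and card: "card (eigenvalues A) < 2"
  obtains k where "A = mat k"
proof -
  obtain m where m: "m \<in> eigenvalues A" and psd: "\<And>x. 0 \<le> x \<bullet> ((mat m - A) *v x)"
    using symmetric_matrix_max_eigenvalue[OF sym] by blast
  have symn: "transpose (- A) = - A"
    using sym by (simp add: transpose_def vec_eq_iff)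
  \<comment> \<open>Applied to \<open>- A\<close>, the maximum yields the least eigenvalue
    \<open>- l\<close> of \<open>A\<close>.\<close>
  obtain l where l: "- l \<in> eigenvalues A" and nsd: "\<And>x. 0 \<le> x \<bullet> ((mat l - - A) *v x)"
    by (rule symmetric_matrix_max_eigenvalue[OF symn]) (simp add: eigenvalues_uminus)
  \<comment> \<open>Finiteness matters: \<open>card\<close> would be 0 on an infinite set.\<close>
  have "m = - l"
    using card_le_Suc0_iff_eq[OF finite_eigenvalues[OF sym]] card m l by auto
  have "transpose (mat m - A) = mat m - A"
    using sym by (auto simp: transpose_def vec_eq_iff mat_def)
  moreover have "x \<bullet> ((mat m - A) *v x) = 0" for x
    using psd[of x] nsd[of x] unfolding shifted_matrix_mult
    by (simp add: \<open>m = - l\<close> uminus_matrix_vector_mult inner_diff_right inner_add_right)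
  ultimately have "(mat m - A) *v x = 0" for x
    using psd by (intro psd_matrix_isotropic_in_kernel)
  then have "mat m - A = 0"
    by (simp add: matrix_eq)
  then show ?thesis
    using that[of m] by simp
qed

lemma two_le_q:
  assumes "simple_graph adj" "adj i j"
  shows "2 \<le> q adj"
proof (rule ccontr)
  assume "\<not> 2 \<le> q adj"
  then obtain A where A: "A \<in> sym_matrices adj" and "card (eigenvalues A) < 2"
    using q_attained[OF assms(1)] by auto
  then obtain k where "A = mat k"
    using symmetric_matrix_few_eigenvalues_scalar[of A] by (auto simp: sym_matrices_def)
  moreover have "i \<noteq> j"
    using assms by (auto simp: simple_graph_def irreflp_def)
  moreover have "A $ i $ j \<noteq> 0"
    using A assms(2) \<open>i \<noteq> j\<close> by (simp add: sym_matrices_def)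
  ultimately show False
    by (simp add: mat_def)
qed

section \<open>Upper bound: a signed adjacency matrix with square 5 I\<close>

lemma q_le:
  assumes "A \<in> sym_matrices adj"
  shows "q adj \<le> card (eigenvalues A)"
  unfolding q_def using assms by (intro Least_le) blast

lemma eigenvalues_square_scalar:
  assumes "\<And>x. A *v (A *v x) = c *\<^sub>R x"
  shows "eigenvalues A \<subseteq> {sqrt c, - sqrt c}"
proof
  fix k assume "k \<in> eigenvalues A"
  then obtain x where x: "x \<noteq> 0" "A *v x = k *\<^sub>R x"
    by (auto simp: eigenvalues_def)
  then have "(k * k) *\<^sub>R x = c *\<^sub>R x"
    using assms[of x] by (simp add: matrix_vector_mult_scaleR)
  then have "c = k\<^sup>2"
    using x by (simp add: power2_eq_square)
  then show "k \<in> {sqrt c, - sqrt c}"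
    by (auto simp: abs_if)
qed

definition bit_sign :: "bool \<Rightarrow> real" where
  "bit_sign b = (if b then - 1 else 1)"

text \<open>The tests identify the flipped bits: an edge changing both bits 1 and 2 changes all
  four. Signs are read at the column \<open>y\<close>, since the \<open>Z\<close> factors act before
  the flips.\<close>

definition signed_clebsch :: "real^(bool^4)^(bool^4)" where
  "signed_clebsch = (\<chi> x y.
     if \<not> clebsch x y then 0
     else if x $ 1 \<noteq> y $ 1 then if x $ 2 = y $ 2 then 1 else bit_sign (y $ 1) * bit_sign (y $ 3)
     else if x $ 2 \<noteq> y $ 2 then bit_sign (y $ 1)
     else if x $ 3 \<noteq> y $ 3 then bit_sign (y $ 1) * bit_sign (y $ 2)
     else bit_sign (y $ 1) * bit_sign (y $ 2) * bit_sign (y $ 3))"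

text \<open>Symmetry: a single flip leaves the bits in its sign alone, and the fourfold flip negates
  both of its sign factors.\<close>

lemma signed_clebsch_in_sym_matrices: "signed_clebsch \<in> sym_matrices clebsch"
proof -
  have "signed_clebsch $ y $ x = signed_clebsch $ x $ y" for x y
  proof -
    obtain a b c d where "x = bits4 a b c d"
      by (rule bits4_cases)
    moreover obtain a' b' c' d' where "y = bits4 a' b' c' d'"
      by (rule bits4_cases)
    ultimately show ?thesis
      by (auto simp: signed_clebsch_def clebsch_bits4 bit_sign_def)
  qed
  then show ?thesis
    by (auto simp: sym_matrices_def vec_eq_iff transpose_def signed_clebsch_def bit_sign_def)
qed

text \<open>Matrix products need real sums, whereas \<open>sum_bool4\<close> is confined to
  \<open>nat\<close>.\<close>

lemma sum_bits4:
  "sum f UNIV = (\<Sum>a\<in>UNIV. \<Sum>b\<in>UNIV. \<Sum>c\<in>UNIV. \<Sum>d\<in>UNIV. f (bits4 a b c d))"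
proof -
  let ?h = "\<lambda>(a, b, c, d). bits4 a b c d"
  have "bij ?h"
    by (rule o_bij[where g = "\<lambda>x. (x $ 1, x $ 2, x $ 3, x $ 4)"])
      (auto simp: fun_eq_iff vec_eq_iff forall_4)
  then have "sum f UNIV = (\<Sum>t\<in>UNIV. f (?h t))"
    by (rule sum.reindex_bij_betw[symmetric])
  also have "\<dots> = (\<Sum>a\<in>UNIV. \<Sum>b\<in>UNIV. \<Sum>c\<in>UNIV. \<Sum>d\<in>UNIV. f (bits4 a b c d))"
    by (simp add: sum.cartesian_product case_prod_beta flip: UNIV_Times_UNIV)
  finally show ?thesis .
qed

lemma signed_clebsch_mult_nth:
  "(signed_clebsch *v w) $ bits4 a b c d =
     w $ bits4 (\<not> a) b c d + bit_sign a * w $ bits4 a (\<not> b) c d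
     + bit_sign a * bit_sign b * w $ bits4 a b (\<not> c) d
     + bit_sign a * bit_sign b * bit_sign c * w $ bits4 a b c (\<not> d)
     + bit_sign a * bit_sign c * w $ bits4 (\<not> a) (\<not> b) (\<not> c) (\<not> d)"
  unfolding matrix_vector_mult_def vec_lambda_beta sum_bits4 sum_UNIV_bool
  by (cases a; cases b; cases c; cases d) (simp_all add: signed_clebsch_def clebsch_bits4 bit_sign_def)

text \<open>Of the 25 two-step walks from a vertex, 5 return with sign 1; the other 20 pair up, two
  per non-neighbour, with opposite signs.\<close>

lemma signed_clebsch_square: "signed_clebsch *v (signed_clebsch *v w) = 5 *\<^sub>R w"
proof -
  have "(signed_clebsch *v (signed_clebsch *v w)) $ bits4 a b c d = 5 * w $ bits4 a b c d"
    for a b c d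
    unfolding signed_clebsch_mult_nth
    by (cases a; cases b; cases c; cases d) (simp_all add: bit_sign_def)
  then show ?thesis
    unfolding vec_eq_iff by (metis bits4_cases vector_scaleR_component real_scaleR_def)
qed

theorem theorem3p2:
  shows "q clebsch = 2"
proof (rule antisym)
  have "q clebsch \<le> card (eigenvalues signed_clebsch)"
    by (rule q_le[OF signed_clebsch_in_sym_matrices])
  also have "\<dots> \<le> card {sqrt 5, - sqrt 5}"
    by (intro card_mono eigenvalues_square_scalar signed_clebsch_square) simp
  also have "\<dots> \<le> 2"
    by (simp add: card_insert_if)
  finally show "q clebsch \<le> 2" .
  have "clebsch (bits4 False False False False) (bits4 True False False False)"
    by (simp add: clebsch_bits4)
  then show "2 \<le> q clebsch"
    by (rule two_le_q[OF simple_graph_clebsch])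
qed

end
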